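(* For all $k,t\in\mathbb{Z}^+$ and all pairs of insertion monotone error measures $(\eta_0,\eta_1)$, $\mathrm{Spill}_{k,t+k+1}$ is $\mathcal{C}_t^{(\eta_0,\eta_1)}$-hard.
   Context: Setting: online minimization problems with binary predictions; an instance is $I=(x,\hat x,r)$ with request sequence $r=\langle r_1,\dots,r_n\rangle$, $x\in\{0,1\}^n$ encoding a fixed optimal solution, $\hat x\in\{0,1\}^n$ its prediction; on receiving $r_i$ a deterministic online algorithm also receives $\hat x_i$ and irrevocably outputs a bit $y_i$. An error measure maps instances to $[0,\infty)$; it is insertion monotone if $\eta(I')\le\eta(I)$ whenever $I'$ is obtained from $I$ by inserting finitely many correctly predicted requests. An algorithm is $(\alpha,\beta,\gamma)$-competitive w.r.t. $(\eta_0,\eta_1)$ if there is a constant $\kappa$ with $\mathrm{Alg}(I)\le\alpha\,\mathrm{Opt}(I)+\beta\,\eta_0(I)+\gamma\,\eta_1(I)+\kappa$ for all $I$. $Q$ is as hard as $P$ (same pair of error measures) if existence of an $(\alpha,\beta,\gamma)$-competitive algorithm for $Q$ implies existence of one for $P$. $\mathrm{ASG}_t$ ($t\in\mathbb{Z}^+$): each request prompts an output bit $y_i$, $\hat x_i$ revealed with the request, $x$ revealed at the end; cost $\sum_i(y_i+t\,x_i(1-y_i))$. $P$ is $\mathcal{C}_t^{(\eta_0,\eta_1)}$-hard if $P$ is as hard as $\mathrm{ASG}_t$. Online $d$-Bounded $k$-Spill with Predictions ($\mathrm{Spill}_{k,d}$): vertex-arrival model (request $r_i$ is a vertex $v_i$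 revealed with its edges to earlier vertices) on simple graphs of maximum degree at most $d$; the algorithm outputs $y_i=1$ to mark $v_i$ as a spill and $y_i=0$ to mark it colorable; feasibility requires the subgraph induced by $\{v_i: y_i=0\}$ to be $k$-colorable (infeasible solutions have infinite cost); cost $\sum_i y_i$; $x$ encodes an optimal solution.
   Formalization: Error measures are taken to be functions of (x, x̂) only, not of the requests r, and competitiveness is considered only for weights β, γ ≥ 0; with r-dependent measures or negative weights the claim is false. *)

theory Defs
  imports "HOL-Library.Extended_Real"
begin

section \<open>Online problems with binary predictions\<close>

record 'r inst =
  truth :: "bool list"   \<comment> \<open>the optimal solution \<open>x\<close>\<close>
  pred :: "bool list"    \<comment> \<open>its prediction \<open>xh\<close>\<close>
  reqs :: "'r list"

text \<open>
  The cost of an output \<open>y\<close> may depend on the whole instance (in the guessing problem below it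
  depends on \<open>x\<close>); infeasible outputs have cost \<open>\<infinity>\<close>.
\<close>

record 'r problem =
  valid_reqs :: "'r list \<Rightarrow> bool"
  cost :: "'r inst \<Rightarrow> bool list \<Rightarrow> ereal"

definition opt :: "'r problem \<Rightarrow> 'r inst \<Rightarrow> ereal" where
  "opt P I = (INF y \<in> {y. length y = length (reqs I)}. cost P I y)"

definition instances :: "'r problem \<Rightarrow> 'r inst set" where
  "instances P = {I. length (truth I) = length (reqs I) \<and> length (pred I) = length (reqs I) \<and>
     valid_reqs P (reqs I) \<and> cost P I (truth I) = opt P I}"

text \<open>
  A deterministic online algorithm computes its next bit from the requests and predictions received
  so far, the current ones included. Its own earlier output is determined by these.
\<close>

type_synonym 'r algorithm = "('r \<times> bool) list \<Rightarrow> bool"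

definition answers :: "'r algorithm \<Rightarrow> 'r inst \<Rightarrow> bool list" where
  "answers A I = map (\<lambda>i. A (take (Suc i) (zip (reqs I) (pred I)))) [0..<length (reqs I)]"


section \<open>Error measures, competitiveness and hardness\<close>

text \<open>
  One and the same error measure is applied to instances of problems with different kinds of
  requests, so it is a function of the part \<open>(x, xh)\<close> that instances of all problems share. Only
  its values on strings of equal length are relevant.
\<close>

type_synonym error_measure = "bool list \<Rightarrow> bool list \<Rightarrow> real"

definition is_error_measure :: "error_measure \<Rightarrow> bool" where
  "is_error_measure \<eta> \<longleftrightarrow> (\<forall>x xh. length x = length xh \<longrightarrow> 0 \<le> \<eta> x xh)"

inductive inserts_correct :: "bool list \<Rightarrow> bool list \<Rightarrow> bool list \<Rightarrow> bool list \<Rightarrow> bool"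
  for x xh where
  none: "inserts_correct x xh x xh"
| one_more: "inserts_correct x xh (u @ v) (uh @ vh) \<Longrightarrow> length u = length uh \<Longrightarrow>
    inserts_correct x xh (u @ b # v) (uh @ b # vh)"

definition insertion_monotone :: "error_measure \<Rightarrow> bool" where
  "insertion_monotone \<eta> \<longleftrightarrow> (\<forall>x xh x' xh'. length x = length xh \<longrightarrow>
     inserts_correct x xh x' xh' \<longrightarrow> \<eta> x' xh' \<le> \<eta> x xh)"

definition competitive ::
  "error_measure \<Rightarrow> error_measure \<Rightarrow> 'r problem \<Rightarrow> real \<Rightarrow> real \<Rightarrow> real \<Rightarrow> 'r algorithm \<Rightarrow> bool" where
  "competitive \<eta>0 \<eta>1 P \<alpha> \<beta> \<gamma> A \<longleftrightarrow> (\<exists>\<kappa>::real. \<forall>I \<in> instances P.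
     cost P I (answers A I) \<le> ereal \<alpha> * opt P I + ereal (\<beta> * \<eta>0 (truth I) (pred I))
       + ereal (\<gamma> * \<eta>1 (truth I) (pred I)) + ereal \<kappa>)"

text \<open>
  The weights \<open>\<beta>\<close> and \<open>\<gamma>\<close> of the errors are nonnegative by convention; no sign condition on
  \<open>\<alpha>\<close> is needed.
\<close>

definition as_hard_as ::
  "error_measure \<Rightarrow> error_measure \<Rightarrow> 'q problem \<Rightarrow> 'p problem \<Rightarrow> bool" where
  "as_hard_as \<eta>0 \<eta>1 Q P \<longleftrightarrow> (\<forall>\<alpha> \<beta> \<gamma>. 0 \<le> \<beta> \<longrightarrow> 0 \<le> \<gamma> \<longrightarrow>
     (\<exists>A. competitive \<eta>0 \<eta>1 Q \<alpha> \<beta> \<gamma> A) \<longrightarrow> (\<exists>B. competitive \<eta>0 \<eta>1 P \<alpha> \<beta> \<gamma> B))"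


section \<open>Asymmetric string guessing\<close>

definition ASG :: "nat \<Rightarrow> unit problem" where
  "ASG t = \<lparr> valid_reqs = (\<lambda>r. True),
     cost = (\<lambda>I y. ereal (\<Sum>i<length (reqs I).
       of_bool (y ! i) + real t * of_bool (truth I ! i) * (1 - of_bool (y ! i)))) \<rparr>"

definition C_hard :: "nat \<Rightarrow> error_measure \<Rightarrow> error_measure \<Rightarrow> 'r problem \<Rightarrow> bool" where
  "C_hard t \<eta>0 \<eta>1 P \<longleftrightarrow> as_hard_as \<eta>0 \<eta>1 P (ASG t)"


section \<open>Bounded-degree spill\<close>

text \<open>
  Vertices are numbered \<open>0, 1, \<dots>\<close> in order of arrival; the request for vertex \<open>i\<close> is the set of
  its neighbours among \<open>{..<i}\<close>.
\<close>

definition adj :: "nat set list \<Rightarrow> nat \<Rightarrow> nat \<Rightarrow> bool" where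
  "adj r i j \<longleftrightarrow> i < length r \<and> j < length r \<and> (j \<in> r ! i \<or> i \<in> r ! j)"

definition vertex_arrival :: "nat set list \<Rightarrow> bool" where
  "vertex_arrival r \<longleftrightarrow> (\<forall>i<length r. r ! i \<subseteq> {..<i})"

definition max_degree_le :: "nat \<Rightarrow> nat set list \<Rightarrow> bool" where
  "max_degree_le d r \<longleftrightarrow> (\<forall>i<length r. card {j. adj r i j} \<le> d)"

definition k_colorable_on :: "nat \<Rightarrow> nat set list \<Rightarrow> nat set \<Rightarrow> bool" where
  "k_colorable_on k r S \<longleftrightarrow> (\<exists>c :: nat \<Rightarrow> nat. (\<forall>i\<in>S. c i < k) \<and>
     (\<forall>i\<in>S. \<forall>j\<in>S. adj r i j \<longrightarrow> c i \<noteq> c j))"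

definition Spill :: "nat \<Rightarrow> nat \<Rightarrow> nat set problem" where
  "Spill k d = \<lparr> valid_reqs = (\<lambda>r. vertex_arrival r \<and> max_degree_le d r),
     cost = (\<lambda>I y. if k_colorable_on k (reqs I) {i. i < length (reqs I) \<and> \<not> y ! i}
       then ereal (\<Sum>i<length (reqs I). of_bool (y ! i)) else \<infinity>) \<rparr>"

end

theory Submission
  imports Defs
begin

text \<open>
  Given a spill algorithm, the guessing algorithm feeds it one isolated vertex per guessed bit and
  copies its answers. Once \<open>x\<close> is known, the adversary continues the graph: every vertex \<open>i\<close> with
  \<open>x\<^sub>i = 1\<close> is followed by a block of \<open>t + k\<close> new vertices, each adjacent to \<open>i\<close> and to all earlier
  \<^emph>\<open>base\<close> vertices of its block. A block vertex becomes a base vertex as long as there are fewer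
  than \<open>k - 1\<close> of them and the algorithm either does not spill it or has already spilled \<open>t\<close>
  vertices of the block. Then the block ends with \<open>k - 1\<close> base vertices, which together with \<open>i\<close>
  and the last vertex of the block form a \<open>(k + 1)\<close>-clique, so that spilling exactly the vertices
  \<open>i\<close> with \<open>x\<^sub>i = 1\<close> is optimal. If the algorithm spills neither \<open>i\<close> nor \<open>t\<close> vertices of the block,
  then all base vertices and some further vertex seeing all of them are unspilled, which is
  infeasible. All block vertices are correctly predicted as not spilled.
\<close>

section \<open>Recursive sets, appended bits, cliques and block sums\<close>

lemma ex_set_course_of_values:
  fixes F :: "nat set \<Rightarrow> nat \<Rightarrow> bool"
  shows "\<exists>B. \<forall>j. j \<in> B \<longleftrightarrow> F (B \<inter> {..<j}) j"
proof -
  \<comment> \<open>\<open>S n\<close> decides the numbers below \<open>n\<close> one by one; it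
    turns out to be the part of \<open>B\<close> below \<open>n\<close>.\<close>
  define S where "S = rec_nat {} (\<lambda>n C. if F C n then insert n C else C)"
  define B where "B = {j. F (S j) j}"
  have mem_B: "j \<in> B \<longleftrightarrow> F (S j) j" for j by (simp add: B_def)
  have "S (Suc n) = (if n \<in> B then insert n (S n) else S n)" for n
    by (simp add: S_def B_def)
  moreover have "S 0 = {}" by (simp add: S_def)
  ultimately have S: "S n = B \<inter> {..<n}" for n
    by (induction n) (auto simp: less_Suc_eq)
  show ?thesis using mem_B unfolding S by blast
qed

lemma inserts_correct_append_replicate:
  "length x = length xh \<Longrightarrow>
    inserts_correct x xh (x @ replicate p b) (xh @ replicate p b)"
proof (induction p)
  case 0
  show ?case by (simp add: inserts_correct.none)
next
  case (Suc p)
  then have "inserts_correct x xh (x @ replicate p b) (xh @ replicate p b)" by simp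
  from inserts_correct.one_more[OF this Suc.prems] show ?case by simp
qed

text \<open>Pigeonhole: a proper colouring is injective on a clique.\<close>

lemma not_k_colorable_on_clique:
  assumes "finite S" "k < card S"
    and "\<And>i j. i \<in> S \<Longrightarrow> j \<in> S \<Longrightarrow> i < j \<Longrightarrow> adj r i j"
  shows "\<not> k_colorable_on k r S"
proof
  assume "k_colorable_on k r S"
  then obtain c where c: "\<forall>i\<in>S. c i < k" "\<forall>i\<in>S. \<forall>j\<in>S. adj r i j \<longrightarrow> c i \<noteq> c j"
    unfolding k_colorable_on_def by blast
  have "inj_on c S"
    using c(2) assms(3) by (intro linorder_inj_onI) auto
  moreover have "c ` S \<subseteq> {..<k}" using c(1) by auto
  ultimately have "card S \<le> card {..<k}" by (intro card_inj_on_le) auto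
  then show False using assms(2) by simp
qed

lemma k_colorable_on_subset:
  "k_colorable_on k r T \<Longrightarrow> S \<subseteq> T \<Longrightarrow> k_colorable_on k r S"
  unfolding k_colorable_on_def by blast

lemma sum_block_split:
  fixes f :: "nat \<Rightarrow> 'a::comm_monoid_add"
  shows "(\<Sum>j<n + p * m. f j) = (\<Sum>j<n. f j) + (\<Sum>i<p. \<Sum>j\<in>{n + i * m..<n + i * m + m}. f j)"
proof (induction p)
  case 0
  show ?case by simp
next
  case (Suc p)
  have "{..<n + Suc p * m} = {..<n + p * m} \<union> {n + p * m..<n + p * m + m}" by auto
  then have "(\<Sum>j<n + Suc p * m. f j)
      = (\<Sum>j<n + p * m. f j) + (\<Sum>j\<in>{n + p * m..<n + p * m + m}. f j)"
    by (simp add: sum.union_disjoint ivl_disj_int)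
  then show ?case using Suc by (simp add: add.assoc)
qed


section \<open>The base of a block\<close>

text \<open>Here \<open>l\<close> is the first vertex of the block and \<open>a\<close> gives the
  algorithm's answers. The rule constrains \<open>B\<close> only inside the block, so one
  \<open>B\<close> can serve all blocks.\<close>

locale block_base =
  fixes k t l :: nat and a :: "nat \<Rightarrow> bool" and B :: "nat set"
  assumes k: "k \<ge> 1"
    and base_iff: "j \<in> {l..<l + (t + k)} \<Longrightarrow>
      j \<in> B \<longleftrightarrow> card (B \<inter> {l..<j}) < k - 1 \<and> (\<not> a j \<or> t \<le> card {i \<in> {l..<j}. a i})"
begin

abbreviation "W \<equiv> {l..<l + (t + k)}"

lemma card_base_le: "j \<le> l + (t + k) \<Longrightarrow> card (B \<inter> {l..<j}) \<le> k - 1"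
proof (induction j)
  case (Suc j)
  show ?case
  proof (cases "j \<in> B \<and> l \<le> j")
    case True
    then have "B \<inter> {l..<Suc j} = insert j (B \<inter> {l..<j})" by auto
    then show ?thesis using base_iff[of j] True Suc.prems by simp
  next
    case False
    then have "B \<inter> {l..<Suc j} = B \<inter> {l..<j}" by (auto simp: less_Suc_eq)
    then show ?thesis using Suc by simp
  qed
qed simp

text \<open>While the base is incomplete, a vertex is rejected only if it is spilled and fewer than
  \<open>t\<close> block vertices before it are spilled. All rejected vertices before the last
  rejected one are such spills, so there are fewer than \<open>t\<close> of them.\<close>

lemma card_nonbase_le:
  assumes "j \<le> l + (t + k)" "card (B \<inter> {l..<j}) < k - 1"
  shows "card ({l..<j} - B) \<le> t"
proof (rule ccontr)
  define D where "D = {l..<j} - B"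
  assume "\<not> card ({l..<j} - B) \<le> t"
  then have D: "t < card D" "finite D" by (auto simp: D_def)
  then have "D \<noteq> {}" by auto
  define d where "d = Max D"
  have d: "d \<in> D" using D(2) \<open>D \<noteq> {}\<close> by (simp add: d_def)
  have spilled: "a i \<and> card {i' \<in> {l..<i}. a i'} < t" if "i \<in> D" for i
  proof -
    have "card (B \<inter> {l..<i}) \<le> card (B \<inter> {l..<j})"
      using that by (intro card_mono) (auto simp: D_def)
    moreover have "i \<in> W" "i \<notin> B" using that assms(1) by (auto simp: D_def)
    ultimately show ?thesis using base_iff[of i] assms(2) by auto
  qed
  have "D - {d} \<subseteq> {i' \<in> {l..<d}. a i'}"
  proof
    fix i assume i: "i \<in> D - {d}"
    then have "i < d" using Max_ge[OF D(2), of i] by (auto simp: d_def)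
    then show "i \<in> {i' \<in> {l..<d}. a i'}" using spilled i by (auto simp: D_def)
  qed
  then have "card (D - {d}) \<le> card {i' \<in> {l..<d}. a i'}" by (intro card_mono) auto
  also have "\<dots> < t" using spilled d by blast
  finally show False using D d by simp
qed

text \<open>Otherwise at most \<open>t\<close> rejected and fewer than \<open>k - 1\<close> base
  vertices would have to make up the \<open>t + k - 1\<close> vertices before the last one.\<close>

lemma card_base_before_last: "card (B \<inter> {l..<l + (t + k) - 1}) = k - 1"
proof (rule ccontr)
  let ?w = "l + (t + k) - 1"
  assume "card (B \<inter> {l..<?w}) \<noteq> k - 1"
  with card_base_le[of ?w] have less: "card (B \<inter> {l..<?w}) < k - 1" by simp
  from card_nonbase_le[OF _ this] have "card ({l..<?w} - B) \<le> t" by simp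
  moreover have "card {l..<?w} = card (B \<inter> {l..<?w}) + card ({l..<?w} - B)"
    by (simp only: card_Int_Diff[OF finite_atLeastLessThan, of _ _ B] Int_commute)
  ultimately show False using less by simp
qed

lemma last_notin_base: "l + (t + k) - 1 \<notin> B"
proof -
  have "l + (t + k) - 1 \<in> W" using k by simp
  from base_iff[OF this] show ?thesis by (simp only: card_base_before_last) simp
qed

lemma base_subset_before_last: "B \<inter> W \<subseteq> {..<l + (t + k) - 1}"
proof
  fix j assume "j \<in> B \<inter> W"
  then have "j \<noteq> l + (t + k) - 1" "j < l + (t + k)" using last_notin_base by auto
  then show "j \<in> {..<l + (t + k) - 1}" by simp
qed

lemma card_base: "card (B \<inter> W) = k - 1"
proof -
  have "B \<inter> W = B \<inter> {l..<l + (t + k) - 1}" using base_subset_before_last by auto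
  then show ?thesis using card_base_before_last by simp
qed

text \<open>With fewer than \<open>t\<close> spills, the clause admitting spilled vertices never
  applies, so the base is unspilled. Of the \<open>t + 1\<close> vertices outside the base, one is
  unspilled as well.\<close>

lemma few_spilled_witness:
  assumes few: "card {j \<in> W. a j} < t"
  shows "\<forall>j \<in> B \<inter> W. \<not> a j"
    and "\<exists>w \<in> W - B. \<not> a w \<and> B \<inter> W \<subseteq> {..<w}"
proof -
  show "\<forall>j \<in> B \<inter> W. \<not> a j"
  proof
    fix j assume j: "j \<in> B \<inter> W"
    have "card {i \<in> {l..<j}. a i} \<le> card {j \<in> W. a j}"
      using j by (intro card_mono) auto
    then show "\<not> a j" using j base_iff[of j] few by auto
  qed
  have "card W = card (B \<inter> W) + card (W - B)"
    by (simp only: card_Int_Diff[OF finite_atLeastLessThan, of _ _ B] Int_commute)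
  then have "card (W - B) = t + 1" using card_base k by simp
  then have "card {j \<in> W. a j} < card (W - B)" using few by linarith
  then have "\<not> W - B \<subseteq> {j \<in> W. a j}"
    using card_mono[of "{j \<in> W. a j}" "W - B"] by auto
  then obtain w where w: "w \<in> W - B" "\<not> a w" by blast
  \<comment> \<open>An unspilled vertex is rejected only when the base is already full, so the whole
    base precedes \<open>w\<close>.\<close>
  then have "card (B \<inter> W) \<le> card (B \<inter> {l..<w})" using base_iff[of w] card_base by auto
  then have "B \<inter> {l..<w} = B \<inter> W"
    using w by (intro card_seteq) auto
  moreover have "B \<inter> {l..<w} \<subseteq> {..<w}" by auto
  ultimately have "B \<inter> W \<subseteq> {..<w}" by (simp only:)
  then show "\<exists>w \<in> W - B. \<not> a w \<and> B \<inter> W \<subseteq> {..<w}" using w by blast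
qed

end


section \<open>The adversarial graph\<close>

definition block_start :: "nat \<Rightarrow> nat \<Rightarrow> nat \<Rightarrow> nat" where
  "block_start n m i = n + i * m"

text \<open>For \<open>j < n\<close> truncated subtraction yields the junk value 0, so uses are
  guarded by \<open>n \<le> j\<close>.\<close>

definition block_of :: "nat \<Rightarrow> nat \<Rightarrow> nat \<Rightarrow> nat" where
  "block_of n m j = (j - n) div m"

text \<open>
  For uniform indexing every \<open>i < length x\<close> owns a block of \<open>m\<close> vertices; it consists of isolated
  vertices if \<open>x\<^sub>i = 0\<close>.
\<close>

definition request :: "nat \<Rightarrow> bool list \<Rightarrow> nat set \<Rightarrow> nat \<Rightarrow> nat set" where
  "request m x B j = (let n = length x; i = block_of n m j in
     if n \<le> j \<and> x ! i then insert i (B \<inter> {block_start n m i..<j}) else {})"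

definition requests :: "nat \<Rightarrow> bool list \<Rightarrow> nat set \<Rightarrow> nat set list" where
  "requests m x B = map (request m x B) [0..<length x + length x * m]"

lemma request_Int_lessThan: "j \<le> p \<Longrightarrow> request m x (B \<inter> {..<p}) j = request m x B j"
proof -
  assume "j \<le> p"
  then have "B \<inter> {..<p} \<inter> {l..<j} = B \<inter> {l..<j}" for l by auto
  then show ?thesis by (simp add: request_def Let_def)
qed

text \<open>\<open>B\<close> unites the bases of all blocks, including those with
  \<open>x ! i\<close> false, where \<open>request\<close> ignores it. At this stage
  \<open>a\<close> is an arbitrary answer function; \<open>ex_adversary\<close> ties it to the
  answers of an algorithm on the graph.\<close>

locale adversary =
  fixes k t :: nat and x :: "bool list" and a :: "nat \<Rightarrow> bool" and B :: "nat set"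
  assumes k: "k \<ge> 1"
    and base: "j \<in> B \<longleftrightarrow> length x \<le> j \<and>
      (let l = block_start (length x) (t + k) (block_of (length x) (t + k) j) in
        card (B \<inter> {l..<j}) < k - 1 \<and> (\<not> a j \<or> t \<le> card {i \<in> {l..<j}. a i}))"
begin

abbreviation "n \<equiv> length x"
abbreviation "m \<equiv> t + k"
abbreviation "start \<equiv> block_start n m"
abbreviation "home \<equiv> block_of n m"
abbreviation "block i \<equiv> {start i..<start i + m}"
abbreviation "N \<equiv> n + n * m"
abbreviation "r \<equiv> requests m x B"

section \<open>Block layout and neighbourhoods\<close>

lemma length_r [simp]: "length r = N"
  by (simp add: requests_def)

lemma nth_r [simp]: "j < N \<Longrightarrow> r ! j = request m x B j"
  by (simp add: requests_def)

lemma home_eq: "j \<in> block i \<Longrightarrow> home j = i"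
  unfolding block_of_def by (rule div_nat_eqI) (auto simp: block_start_def mult.commute)

lemma mem_block_home: "n \<le> j \<Longrightarrow> j \<in> block (home j)"
proof -
  assume "n \<le> j"
  moreover have "j - n = (j - n) div m * m + (j - n) mod m"
    by (simp only: div_mult_mod_eq)
  moreover have "(j - n) mod m < m" using k by simp
  ultimately show ?thesis unfolding block_of_def block_start_def atLeastLessThan_iff by linarith
qed

lemma home_less: "j < N \<Longrightarrow> n \<le> j \<Longrightarrow> home j < n"
  using k by (simp add: block_of_def less_mult_imp_div_less)

lemma start_ge: "n \<le> start i"
  by (simp add: block_start_def)

lemma block_less: "i < n \<Longrightarrow> j \<in> block i \<Longrightarrow> j < N"
proof -
  assume "i < n" "j \<in> block i"
  moreover from \<open>i < n\<close> have "Suc i * m \<le> n * m" by (intro mult_right_mono) auto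
  ultimately show ?thesis by (simp add: block_start_def)
qed

lemma request_block:
  "i < n \<Longrightarrow> x ! i \<Longrightarrow> j \<in> block i \<Longrightarrow> request m x B j = insert i (B \<inter> {start i..<j})"
  using home_eq[of j i] start_ge[of i] by (simp add: request_def Let_def)

lemma mem_requestD:
  assumes "j' \<in> request m x B j"
  shows "n \<le> j" "x ! home j" "j' = home j \<or> j' \<in> B \<and> j' \<in> block (home j) \<and> j' < j"
  using assms mem_block_home[of j] by (auto simp: request_def Let_def split: if_splits)

lemma block_base: "block_base k t (start i) a B"
proof
  show "k \<ge> 1" by (rule k)
  fix j assume "j \<in> block i"
  then show "j \<in> B \<longleftrightarrow> card (B \<inter> {start i..<j}) < k - 1 \<and>
      (\<not> a j \<or> t \<le> card {i' \<in> {start i..<j}. a i'})"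
    using base[of j] home_eq[of j i] start_ge[of i] by (simp add: Let_def)
qed

lemma vertex_arrival: "vertex_arrival r"
  unfolding vertex_arrival_def
proof (intro allI impI subsetI)
  fix j j' assume "j < length r" "j' \<in> r ! j"
  then have "j < N" "j' \<in> request m x B j" by simp_all
  then show "j' \<in> {..<j}" using home_less[of j] mem_requestD[of j' j] by auto
qed

text \<open>Every edge joins two vertices of one group, an owner with its block, and a group has
  \<open>1 + (t + k)\<close> vertices.\<close>

lemma max_degree: "max_degree_le (t + k + 1) r"
  unfolding max_degree_le_def
proof (intro allI impI)
  fix j assume "j < length r"
  define i where "i = (if j < n then j else home j)"
  have "{j'. adj r j j'} \<subseteq> insert i (block i)"
  proof
    fix j' assume "j' \<in> {j'. adj r j j'}"
    then have lt: "j < N" "j' < N" and "j' \<in> request m x B j \<or> j \<in> request m x B j'"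
      by (auto simp: adj_def)
    then show "j' \<in> insert i (block i)"
    proof (elim disjE)
      assume "j' \<in> request m x B j"
      from mem_requestD[OF this] show ?thesis by (auto simp: i_def)
    next
      assume "j \<in> request m x B j'"
      note * = mem_requestD[OF this]
      then have "home j' < n" using home_less lt by blast
      moreover have "home j = home j' \<and> n \<le> j" if "j \<in> block (home j')"
        using home_eq[OF that] that start_ge[of "home j'"] by simp
      ultimately have "i = home j'" using *(3) by (auto simp: i_def)
      then show ?thesis using mem_block_home[OF *(1)] by simp
    qed
  qed
  then have "card {j'. adj r j j'} \<le> card (insert i (block i))" by (intro card_mono) auto
  also have "\<dots> \<le> t + k + 1" by (simp add: card_insert_if)
  finally show "card {j'. adj r j j'} \<le> t + k + 1" .
qed

text \<open>Without the owners of nonempty requests, every edge has a base vertex as its earlier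
  end. Base vertices take their rank within the base, at most \<open>k - 2\<close>, as colour; all
  others share the colour \<open>k - 1\<close>.\<close>

lemma truth_feasible: "k_colorable_on k r {j. j < N \<and> \<not> (x @ replicate (n * m) False) ! j}"
proof -
  define c where "c j = (if j \<in> B then card (B \<inter> {start (home j)..<j}) else k - 1)" for j
  have base_home: "card (B \<inter> {start (home j)..<j}) < k - 1" if "j \<in> B" for j
    using that base[of j] by (simp add: Let_def)
  have *: "c j \<noteq> c j'"
    if "j \<in> request m x B j'" "j' < N" "\<not> (x @ replicate (n * m) False) ! j" for j j'
  proof -
    note mem = mem_requestD[OF that(1)]
    have "home j' < n" using home_less mem(1) that(2) by blast
    then have "j \<noteq> home j'" using that(3) mem(2) by (auto simp: nth_append)
    then have j: "j \<in> B" "j \<in> block (home j')" "j < j'" using mem(3) by auto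
    note h = home_eq[OF j(2)]
    show ?thesis
    proof (cases "j' \<in> B")
      case True
      have "card (B \<inter> {start (home j)..<j}) < card (B \<inter> {start (home j')..<j'})"
        using j h by (intro psubset_card_mono) auto
      then show ?thesis using True j(1) by (simp add: c_def)
    next
      case False
      then show ?thesis using base_home[OF j(1)] j(1) by (simp add: c_def)
    qed
  qed
  show ?thesis
    unfolding k_colorable_on_def
  proof (intro exI[of _ c] conjI ballI impI)
    fix j show "c j < k" using base_home[of j] k by (auto simp: c_def)
  next
    fix j j'
    assume "j \<in> {j. j < N \<and> \<not> (x @ replicate (n * m) False) ! j}"
      "j' \<in> {j. j < N \<and> \<not> (x @ replicate (n * m) False) ! j}" "adj r j j'"
    then show "c j \<noteq> c j'" using *[of j j'] *[of j' j] by (auto simp: adj_def)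
  qed
qed

text \<open>The owner, the \<open>k - 1\<close> base vertices and \<open>w\<close> form a
  \<open>(k + 1)\<close>-clique, so they cannot all be unspilled.\<close>

lemma feasible_spills_clique:
  assumes i: "i < n" "x ! i" and w: "w \<in> block i" "w \<notin> B" "B \<inter> block i \<subseteq> {..<w}"
    and feasible: "k_colorable_on k r {j. j < N \<and> \<not> y j}"
  shows "\<exists>j \<in> insert i (insert w (B \<inter> block i)). y j"
proof (rule ccontr)
  let ?S = "insert i (insert w (B \<inter> block i))"
  assume "\<not> ?thesis"
  moreover have lt: "j < N" if "j \<in> ?S" for j using that i w block_less[OF i(1)] by auto
  ultimately have "?S \<subseteq> {j. j < N \<and> \<not> y j}" by blast
  with feasible have "k_colorable_on k r ?S" by (rule k_colorable_on_subset)
  moreover have "\<not> k_colorable_on k r ?S"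
  proof (rule not_k_colorable_on_clique)
    have "i \<notin> block i" using i(1) start_ge[of i] by simp
    moreover from this w(1) have "i \<noteq> w" by blast
    ultimately have "card ?S = Suc (Suc (card (B \<inter> block i)))" using w by simp
    then show "k < card ?S" using block_base.card_base[OF block_base] k by simp
  next
    fix j j' assume S: "j \<in> ?S" "j' \<in> ?S" and "j < j'"
    \<comment> \<open>The owner is the earliest of the clique and \<open>w\<close> the latest, so
      the later vertex \<open>j'\<close> lists \<open>j\<close> in its request.\<close>
    have "j' \<noteq> i"
      using S(1) \<open>j < j'\<close> w(1) i(1) start_ge[of i] by auto
    then have j': "j' \<in> block i" using S(2) w(1) by auto
    have "j \<noteq> w" using S(2) \<open>j < j'\<close> w \<open>j' \<noteq> i\<close> by auto
    then have "j \<in> request m x B j'"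
      using request_block[OF i j'] S(1) \<open>j < j'\<close> by auto
    then show "adj r j j'" using lt[OF S(1)] lt[OF S(2)] by (simp add: adj_def)
  qed simp
  ultimately show False by contradiction
qed

section \<open>Spills forced in each block and the resulting costs\<close>

lemma card_eq_sum_block: "(\<Sum>j\<in>block i. of_bool (y j)) = real (card {j \<in> block i. y j})"
proof -
  have "{j \<in> block i. y j} = block i \<inter> Collect y" by blast
  then show ?thesis by (simp only: sum_of_bool_eq finite_atLeastLessThan)
qed

text \<open>This gives the lower bound on the optimum, for arbitrary outputs
  \<open>y\<close>.\<close>

lemma feasible_spills_one:
  assumes i: "i < n" and feasible: "k_colorable_on k r {j. j < N \<and> \<not> y j}"
  shows "of_bool (x ! i) \<le> of_bool (y i) + (\<Sum>j\<in>block i. of_bool (y j) :: real)"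
proof (cases "x ! i \<and> \<not> y i")
  case True
  \<comment> \<open>Whatever \<open>a\<close> is, the last block vertex sees the whole base, so it
    completes a clique independently of \<open>y\<close>.\<close>
  let ?w = "start i + m - 1"
  have w: "?w \<in> block i" using k by auto
  obtain j where "j \<in> insert i (insert ?w (B \<inter> block i))" "y j"
    using feasible_spills_clique[OF i _ w _ _ feasible] True
      block_base.last_notin_base[OF block_base] block_base.base_subset_before_last[OF block_base]
    by blast
  then have "j \<in> {j \<in> block i. y j}" using True w by auto
  then have "card {j \<in> block i. y j} > 0" by (auto simp: card_gt_0_iff)
  then show ?thesis using True by (simp only: card_eq_sum_block) auto
qed (auto simp: sum_nonneg)

text \<open>Here the output is the same \<open>a\<close> that shaped \<open>B\<close>: with
  \<open>i\<close> unspilled and fewer than \<open>t\<close> spills in the block, the witness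
  \<open>w\<close> would complete an unspilled clique. The left-hand side is the guessing cost at
  position \<open>i\<close>.\<close>

lemma feasible_spills_many:
  assumes i: "i < n" and feasible: "k_colorable_on k r {j. j < N \<and> \<not> a j}"
  shows "of_bool (a i) + real t * of_bool (x ! i) * (1 - of_bool (a i))
    \<le> of_bool (a i) + (\<Sum>j\<in>block i. of_bool (a j))"
proof (cases "x ! i \<and> \<not> a i")
  case True
  have "t \<le> card {j \<in> block i. a j}"
  proof (rule ccontr)
    assume "\<not> ?thesis"
    then have "card {j \<in> block i. a j} < t" by simp
    note few = block_base.few_spilled_witness[OF block_base this]
    then obtain w where w: "w \<in> block i" "w \<notin> B" "\<not> a w" "B \<inter> block i \<subseteq> {..<w}" by blast
    from feasible_spills_clique[OF i _ w(1,2,4) feasible] True few(1) w(3) show False by blast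
  qed
  then show ?thesis using True by (simp only: card_eq_sum_block) auto
qed (auto simp: sum_nonneg)

lemma sum_vertices:
  "(\<Sum>j<N. f j) = (\<Sum>i<n. f i + (\<Sum>j\<in>block i. f j))" for f :: "nat \<Rightarrow> real"
  by (simp add: sum_block_split sum.distrib block_start_def)

lemma valid: "valid_reqs (Spill k (t + k + 1)) r"
  using vertex_arrival max_degree by (simp add: Spill_def)

lemma cost_truth:
  assumes "reqs I = r" "truth I = x @ replicate (n * m) False"
  shows "cost (Spill k (t + k + 1)) I (truth I) = ereal (\<Sum>i<n. of_bool (x ! i))"
proof -
  have block: "(\<Sum>j\<in>block i. of_bool ((x @ replicate (n * m) False) ! j)) = (0::real)"
    if "i < n" for i
  proof (intro sum.neutral ballI)
    fix j assume "j \<in> block i"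
    then have "n \<le> j" "j < N" using block_less[OF that] start_ge[of i] by auto
    then show "of_bool ((x @ replicate (n * m) False) ! j) = (0::real)"
      by (simp add: nth_append)
  qed
  have "(\<Sum>j<N. of_bool ((x @ replicate (n * m) False) ! j)) = (\<Sum>i<n. of_bool (x ! i) :: real)"
    unfolding sum_vertices using block by (intro sum.cong) (auto simp: nth_append)
  then show ?thesis
    using truth_feasible by (simp add: Spill_def assms)
qed

lemma opt_eq:
  assumes "reqs I = r" "truth I = x @ replicate (n * m) False"
  shows "opt (Spill k (t + k + 1)) I = ereal (\<Sum>i<n. of_bool (x ! i))"
  unfolding opt_def
proof (rule antisym)
  show "(INF y\<in>{y. length y = length (reqs I)}. cost (Spill k (t + k + 1)) I y)
      \<le> ereal (\<Sum>i<n. of_bool (x ! i))"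
    using cost_truth[OF assms] assms by (intro INF_lower2[of "truth I"]) auto
  show "ereal (\<Sum>i<n. of_bool (x ! i))
      \<le> (INF y\<in>{y. length y = length (reqs I)}. cost (Spill k (t + k + 1)) I y)"
  proof (rule INF_greatest)
    fix y
    have "(\<Sum>i<n. of_bool (x ! i)) \<le> (\<Sum>j<N. of_bool (y ! j) :: real)"
      if "k_colorable_on k r {j. j < N \<and> \<not> y ! j}"
      unfolding sum_vertices using feasible_spills_one[OF _ that] by (intro sum_mono) auto
    then show "ereal (\<Sum>i<n. of_bool (x ! i)) \<le> cost (Spill k (t + k + 1)) I y"
      by (simp add: Spill_def assms)
  qed
qed

lemma cost_answers_ge:
  assumes "reqs I = r" "y = map a [0..<N]"
  shows "ereal (\<Sum>i<n. of_bool (a i) + real t * of_bool (x ! i) * (1 - of_bool (a i)))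
    \<le> cost (Spill k (t + k + 1)) I y"
proof -
  have "(\<Sum>i<n. of_bool (a i) + real t * of_bool (x ! i) * (1 - of_bool (a i)))
      \<le> (\<Sum>j<N. of_bool (a j))"
    if "k_colorable_on k r {j. j < N \<and> \<not> a j}"
    unfolding sum_vertices using feasible_spills_many[OF _ that] by (intro sum_mono) auto
  moreover have "{j. j < N \<and> \<not> y ! j} = {j. j < N \<and> \<not> a j}" using assms(2) by auto
  moreover have "(\<Sum>j<N. of_bool (y ! j) :: real) = (\<Sum>j<N. of_bool (a j))"
    using assms(2) by (intro sum.cong) auto
  ultimately show ?thesis by (simp add: Spill_def assms(1))
qed

end


section \<open>The reduction\<close>

text \<open>The first \<open>length x\<close> requests are empty whatever \<open>x\<close> is, so
  the spill algorithm can be simulated before \<open>x\<close> is known.\<close>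

definition guess :: "nat set algorithm \<Rightarrow> unit algorithm" where
  "guess A h = A (map (\<lambda>(_, p). ({}, p)) h)"

text \<open>The set \<open>B\<close> shapes the requests, these determine the answers, and the
  answers determine \<open>B\<close>. The circle is resolved by recursion, since the answer at
  \<open>j\<close> depends only on the members of \<open>B\<close> below \<open>j\<close>.\<close>

lemma ex_adversary:
  fixes A :: "nat set algorithm" and x ph :: "bool list"
  assumes "k \<ge> 1"
  shows "\<exists>B. adversary k t x
    (\<lambda>j. A (zip (map (request (t + k) x B) [0..<Suc j]) (take (Suc j) ph))) B"
proof -
  let ?n = "length x" and ?m = "t + k"
  let ?l = "\<lambda>j. block_start ?n ?m (block_of ?n ?m j)"
  define a where "a B j = A (zip (map (request ?m x B) [0..<Suc j]) (take (Suc j) ph))" for B j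
  define F where "F C j \<longleftrightarrow> ?n \<le> j \<and> card (C \<inter> {?l j..<j}) < k - 1 \<and>
    (\<not> a C j \<or> t \<le> card {i \<in> {?l j..<j}. a C i})" for C j
  obtain B where B: "\<And>j. j \<in> B \<longleftrightarrow> F (B \<inter> {..<j}) j"
    using ex_set_course_of_values[of F] by blast
  have a: "a (B \<inter> {..<p}) j = a B j" if "j \<le> p" for j p
  proof -
    have "map (request ?m x (B \<inter> {..<p})) [0..<Suc j] = map (request ?m x B) [0..<Suc j]"
      using that by (intro map_cong refl request_Int_lessThan) auto
    then show ?thesis by (simp only: a_def)
  qed
  have "F (B \<inter> {..<j}) j \<longleftrightarrow> F B j" for j
  proof -
    have "{i \<in> {?l j..<j}. a (B \<inter> {..<j}) i} = {i \<in> {?l j..<j}. a B i}" using a by auto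
    moreover have "B \<inter> {..<j} \<inter> {?l j..<j} = B \<inter> {?l j..<j}" by auto
    ultimately show ?thesis by (simp only: F_def a order_refl)
  qed
  with B have "j \<in> B \<longleftrightarrow> F B j" for j by blast
  then have "adversary k t x (a B) B"
    using assms by unfold_locales (simp_all add: F_def Let_def)
  then show ?thesis unfolding a_def by blast
qed

lemma competitive_guess:
  assumes k: "k \<ge> 1"
    and mono: "insertion_monotone \<eta>0" "insertion_monotone \<eta>1"
    and weights: "0 \<le> \<beta>" "0 \<le> \<gamma>"
    and A: "competitive \<eta>0 \<eta>1 (Spill k (t + k + 1)) \<alpha> \<beta> \<gamma> A"
  shows "competitive \<eta>0 \<eta>1 (ASG t) \<alpha> \<beta> \<gamma> (guess A)"
proof -
  let ?P = "Spill k (t + k + 1)" and ?m = "t + k"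
  from A obtain \<kappa> where \<kappa>: "\<And>I. I \<in> instances ?P \<Longrightarrow>
      cost ?P I (answers A I) \<le> ereal \<alpha> * opt ?P I + ereal (\<beta> * \<eta>0 (truth I) (pred I))
        + ereal (\<gamma> * \<eta>1 (truth I) (pred I)) + ereal \<kappa>"
    unfolding competitive_def by blast
  show ?thesis
    unfolding competitive_def
  proof (intro exI[of _ \<kappa>] ballI)
    fix I assume "I \<in> instances (ASG t)"
    define x xh where "x = truth I" and "xh = pred I"
    from \<open>I \<in> instances (ASG t)\<close> have len: "length (reqs I) = length x" "length xh = length x"
      and opt_I: "cost (ASG t) I x = opt (ASG t) I"
      by (auto simp: instances_def x_def xh_def)
    \<comment> \<open>The block vertices have truth and prediction both
      \<open>False\<close>.\<close>
    define z where "z = replicate (length x * ?m) False"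
    obtain B where adv: "adversary k t x
        (\<lambda>j. A (zip (map (request ?m x B) [0..<Suc j]) (take (Suc j) (xh @ z)))) B"
      using ex_adversary[OF k] by blast
    define a where "a j = A (zip (map (request ?m x B) [0..<Suc j]) (take (Suc j) (xh @ z)))" for j
    interpret adversary k t x a B using adv by (simp only: a_def[abs_def])
    define J where "J = \<lparr>truth = x @ z, pred = xh @ z, reqs = r\<rparr>"
    have J: "reqs J = r" "truth J = x @ replicate (length x * ?m) False" "pred J = xh @ z"
      by (simp_all add: J_def z_def)
    have "J \<in> instances ?P"
      using cost_truth[OF J(1,2)] opt_eq[OF J(1,2)] valid len
      by (simp add: instances_def J z_def)
    note le = \<kappa>[OF this]
    have "answers A J = map a [0..<length x + length x * ?m]"
      unfolding answers_def J length_r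
    proof (intro map_cong refl)
      fix j assume "j \<in> set [0..<length x + length x * ?m]"
      then have "take (Suc j) r = map (request ?m x B) [0..<Suc j]"
        by (simp add: requests_def take_map del: upt_Suc)
      then show "A (take (Suc j) (zip r (xh @ z))) = a j" by (simp only: a_def take_zip)
    qed
    note ge = cost_answers_ge[OF J(1) this]
    have guess: "answers (guess A) I ! j = a j" if "j < length x" for j
    proof -
      \<comment> \<open>Positions up to \<open>j\<close> are owners: their requests are empty and
        their predictions come from \<open>xh\<close>, not from \<open>z\<close>.\<close>
      have "map (\<lambda>(_, p). ({}, p)) (take (Suc j) (zip (reqs I) xh))
          = zip (map (request ?m x B) [0..<Suc j]) (take (Suc j) (xh @ z))"
        using that len
        by (intro nth_equalityI) (auto simp: request_def nth_append simp del: upt_Suc)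
      then show ?thesis using that len by (simp add: answers_def guess_def a_def xh_def)
    qed
    have "cost (ASG t) I (answers (guess A) I)
        = ereal (\<Sum>i<length x. of_bool (a i) + real t * of_bool (x ! i) * (1 - of_bool (a i)))"
      using len guess by (auto simp: ASG_def x_def[symmetric] intro!: sum.cong)
    also have "\<dots> \<le> ereal \<alpha> * opt ?P J + ereal (\<beta> * \<eta>0 (truth J) (pred J))
        + ereal (\<gamma> * \<eta>1 (truth J) (pred J)) + ereal \<kappa>"
      using ge le by (rule order_trans)
    \<comment> \<open>Guessing \<open>x\<close> itself costs its number of ones, which is also the
      spill optimum. Equality, not just a bound, is used because \<alpha> may have either
      sign.\<close>
    also have "opt ?P J = opt (ASG t) I"
    proof -
      have "cost (ASG t) I x = ereal (\<Sum>i<length x. of_bool (x ! i))"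
        using len by (auto simp: ASG_def x_def simp del: sum_of_bool_eq intro!: sum.cong)
      then show ?thesis using opt_I opt_eq[OF J(1,2)] by simp
    qed
    finally have *: "cost (ASG t) I (answers (guess A) I)
      \<le> ereal \<alpha> * opt (ASG t) I + ereal (\<beta> * \<eta>0 (truth J) (pred J))
        + ereal (\<gamma> * \<eta>1 (truth J) (pred J)) + ereal \<kappa>" .
    \<comment> \<open>The blocks act as correctly predicted insertions, so neither error
      grows.\<close>
    have "inserts_correct x xh (truth J) (pred J)"
      using inserts_correct_append_replicate[of x xh] len by (simp add: J z_def)
    then have "\<eta>0 (truth J) (pred J) \<le> \<eta>0 x xh" "\<eta>1 (truth J) (pred J) \<le> \<eta>1 x xh"
      using mono len unfolding insertion_monotone_def by metis+
    then have "ereal (\<beta> * \<eta>0 (truth J) (pred J)) \<le> ereal (\<beta> * \<eta>0 x xh)"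
      "ereal (\<gamma> * \<eta>1 (truth J) (pred J)) \<le> ereal (\<gamma> * \<eta>1 x xh)"
      using weights by (simp_all add: mult_left_mono)
    then show "cost (ASG t) I (answers (guess A) I)
      \<le> ereal \<alpha> * opt (ASG t) I + ereal (\<beta> * \<eta>0 (truth I) (pred I))
        + ereal (\<gamma> * \<eta>1 (truth I) (pred I)) + ereal \<kappa>"
      unfolding x_def[symmetric] xh_def[symmetric]
      by (intro order_trans[OF *] add_mono order_refl)
  qed
qed

theorem theorem43:
  fixes k t :: nat and \<eta>0 \<eta>1 :: error_measure
  assumes "k \<ge> 1" and "t \<ge> 1"
    and "is_error_measure \<eta>0" and "is_error_measure \<eta>1"
    and "insertion_monotone \<eta>0" and "insertion_monotone \<eta>1"
  shows "C_hard t \<eta>0 \<eta>1 (Spill k (t + k + 1))"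
  unfolding C_hard_def as_hard_as_def
  using competitive_guess[OF assms(1,5,6)] by blast

end
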